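(* For any $\alpha_H,\alpha_G>1$, there is an $n$-node DAG $G$ such that any $(\alpha_H\to\alpha_G)$-stretch shortest-paths preserving graph $H$ of $G$ has aspect ratio $(\alpha_H)^{\Omega(\sqrt{n})}$.
   Context: The aspect ratio of a graph with positive edge weights $w$ is $\max_e w(e)/\min_e w(e)$. A path $\pi$ from $s$ to $t$ is an $\alpha$-approximate shortest path in a weighted graph if its weight is at most $\alpha$ times the $s$-$t$ distance. Given a graph $G=(V,E,w)$, a reweighted graph $H=(V,E,w_H)$ on the same vertex and edge set with positive weights is called $(\alpha_H\to\alpha_G)$-stretch shortest-paths preserving if every $\alpha_H$-approximate shortest path in $H$ is also an $\alpha_G$-approximate shortest path in $G$. *)

theory Defs
  imports "HOL-Analysis.Analysis" "Graph_Theory.Graph_Theory"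
begin

locale dag = digraph +
  assumes no_cycle: "\<not> cycle p"

definition positive_weights :: "('a, 'b) pre_digraph \<Rightarrow> 'b weight_fun \<Rightarrow> bool" where
  "positive_weights G w \<longleftrightarrow> (\<forall>e \<in> arcs G. 0 < w e)"

text \<open>The aspect ratio is only meaningful for finitely many arcs and at least one arc.\<close>

definition aspect_ratio :: "('a, 'b) pre_digraph \<Rightarrow> 'b weight_fun \<Rightarrow> real" where
  "aspect_ratio G w = Max (w ` arcs G) / Min (w ` arcs G)"

context wf_digraph
begin

definition approx_shortest_path ::
  "'b weight_fun \<Rightarrow> real \<Rightarrow> 'a \<Rightarrow> 'b awalk \<Rightarrow> 'a \<Rightarrow> bool" where
  "approx_shortest_path w \<alpha> s p t \<longleftrightarrow>
     apath s p t \<and> ereal (awalk_cost w p) \<le> ereal \<alpha> * \<mu> w s t"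

text \<open>A reweighting has the same vertices and arcs, so it is represented by its weight
  function \<open>w\<^sub>H\<close> alone; \<open>w\<^sub>G\<close> holds the original weights.\<close>

definition stretch_preserving ::
  "'b weight_fun \<Rightarrow> 'b weight_fun \<Rightarrow> real \<Rightarrow> real \<Rightarrow> bool" where
  "stretch_preserving w\<^sub>G w\<^sub>H \<alpha>\<^sub>H \<alpha>\<^sub>G \<longleftrightarrow>
     positive_weights G w\<^sub>H \<and>
     (\<forall>s p t. approx_shortest_path w\<^sub>H \<alpha>\<^sub>H s p t \<longrightarrow> approx_shortest_path w\<^sub>G \<alpha>\<^sub>G s p t)"

end

end

theory Submission
  imports Defs
begin

text \<open>
  The graph is the directed \<open>(k + 1) \<times> (k + 1)\<close> grid with \<open>k\<close> about \<open>sqrt n\<close>, padded with isolated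
  vertices. The weights decrease geometrically from each row to the next and increase geometrically
  from each column to the next, so that in every unit square ``right, down'' costs \<open>2 \<alpha>\<^sub>G\<close> times as
  much as ``down, right''. These are the only two paths between opposite corners of the square, so
  a stretch-preserving \<open>w\<^sub>H\<close> has to make the former more than \<open>\<alpha>\<^sub>H\<close> times as heavy as the latter.
  Weighting the inequality of square \<open>(i, j)\<close> with \<open>\<alpha>\<^sub>H ^ i / \<alpha>\<^sub>H ^ j\<close> makes all interior arcs cancel
  in the sum over all squares; the remaining boundary terms give aspect ratio at least \<open>\<alpha>\<^sub>H ^ k\<close>.
\<close>

section \<open>Telescoping the weighted square inequalities\<close>

lemma grid_inequalities_imp_ratio:
  fixes r d :: "nat \<Rightarrow> nat \<Rightarrow> real"
  assumes a: "a > 0" and k: "k > 0"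
    and cell: "\<And>i j. i < k \<Longrightarrow> j < k \<Longrightarrow> a * (d i j + r (Suc i) j) \<le> r i j + d i (Suc j)"
    and upper: "\<And>j. j < k \<Longrightarrow> r 0 j \<le> M" "\<And>i. i < k \<Longrightarrow> d i k \<le> M"
    and lower: "\<And>j. j < k \<Longrightarrow> m \<le> r k j" "\<And>i. i < k \<Longrightarrow> m \<le> d i 0"
  shows "a ^ k * m \<le> M"
proof -
  \<comment> \<open>\<open>S\<close> is the common scale of the four boundary sums: the coefficients
    add up to \<open>S\<close> on the top row and the last column, and to \<open>a ^ k * S\<close>
    on the bottom row and the first column. It therefore cancels at the end.\<close>
  define S where "S = (\<Sum>j<k. 1 / a ^ j)"
  have S_pos: "S > 0"
    unfolding S_def using a k by (intro sum_pos) auto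
  have T: "(\<Sum>i<k. a ^ Suc i) = a ^ k * S"
  proof -
    have "(\<Sum>i<k. a ^ Suc i) = (\<Sum>i<k. a ^ Suc (k - Suc i))"
      by (rule sum.nat_diff_reindex[symmetric])
    also have "\<dots> = (\<Sum>i<k. a ^ k * (1 / a ^ i))"
      using a by (intro sum.cong refl) (simp add: Suc_diff_Suc power_diff)
    finally show ?thesis
      by (simp add: S_def sum_distrib_left)
  qed
  have rows: "(\<Sum>i<k. \<Sum>j<k. a ^ i / a ^ j * (r i j - a * r (Suc i) j)) =
      (\<Sum>j<k. r 0 j / a ^ j) - a ^ k * (\<Sum>j<k. r k j / a ^ j)"
  proof -
    have "(\<Sum>i<k. \<Sum>j<k. a ^ i / a ^ j * (r i j - a * r (Suc i) j)) =
        (\<Sum>j<k. \<Sum>i<k. a ^ i * r i j / a ^ j - a ^ Suc i * r (Suc i) j / a ^ j)"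
      by (subst sum.swap) (simp add: algebra_simps)
    also have "\<dots> = (\<Sum>j<k. a ^ 0 * r 0 j / a ^ j - a ^ k * r k j / a ^ j)"
      by (subst sum_lessThan_telescope') (rule refl)
    finally show ?thesis
      by (simp add: sum_subtractf sum_distrib_left)
  qed
  have cols: "(\<Sum>i<k. \<Sum>j<k. a ^ i / a ^ j * (d i (Suc j) - a * d i j)) =
      (\<Sum>i<k. a ^ Suc i * d i k) / a ^ k - (\<Sum>i<k. a ^ Suc i * d i 0)"
  proof -
    have "(\<Sum>j<k. a ^ i / a ^ j * (d i (Suc j) - a * d i j)) =
        a ^ Suc i * (d i k / a ^ k - d i 0 / a ^ 0)" for i
    proof -
      \<comment> \<open>Pulling out \<open>a ^ Suc i\<close> instead of \<open>a ^ i\<close> gives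
        \<open>d i (Suc j)\<close> and \<open>d i j\<close> consecutive powers as denominators, so
        the sum telescopes in \<open>j\<close>.\<close>
      have "(\<Sum>j<k. a ^ i / a ^ j * (d i (Suc j) - a * d i j)) =
          (\<Sum>j<k. a ^ Suc i * (d i (Suc j) / a ^ Suc j - d i j / a ^ j))"
        using a by (intro sum.cong refl) (simp add: field_simps)
      also have "\<dots> = a ^ Suc i * (\<Sum>j<k. d i (Suc j) / a ^ Suc j - d i j / a ^ j)"
        by (simp only: sum_distrib_left)
      also have "\<dots> = a ^ Suc i * (d i k / a ^ k - d i 0 / a ^ 0)"
        by (subst sum_lessThan_telescope) (rule refl)
      finally show ?thesis .
    qed
    then show ?thesis
      by (simp add: sum_subtractf sum_divide_distrib right_diff_distrib)
  qed
  have "0 \<le> (\<Sum>i<k. \<Sum>j<k. a ^ i / a ^ j * (r i j + d i (Suc j) - a * (d i j + r (Suc i) j)))"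
    using a cell by (intro sum_nonneg mult_nonneg_nonneg) auto
  also have "\<dots> = (\<Sum>i<k. \<Sum>j<k. a ^ i / a ^ j * (r i j - a * r (Suc i) j)) +
      (\<Sum>i<k. \<Sum>j<k. a ^ i / a ^ j * (d i (Suc j) - a * d i j))"
    unfolding sum.distrib[symmetric] by (intro sum.cong refl) (simp add: algebra_simps)
  finally have bal: "a ^ k * (\<Sum>j<k. r k j / a ^ j) + (\<Sum>i<k. a ^ Suc i * d i 0) \<le>
      (\<Sum>j<k. r 0 j / a ^ j) + (\<Sum>i<k. a ^ Suc i * d i k) / a ^ k"
    unfolding rows cols by linarith
  have "m * S \<le> (\<Sum>j<k. r k j / a ^ j)"
    unfolding S_def sum_distrib_left using a lower(1)
    by (intro sum_mono) (simp add: divide_right_mono)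
  then have "a ^ k * (m * S) \<le> a ^ k * (\<Sum>j<k. r k j / a ^ j)"
    using a by simp
  moreover have "a ^ k * S * m \<le> (\<Sum>i<k. a ^ Suc i * d i 0)"
    unfolding T[symmetric] sum_distrib_right using a lower(2) by (intro sum_mono mult_left_mono) auto
  moreover have "(\<Sum>j<k. r 0 j / a ^ j) \<le> M * S"
    unfolding S_def sum_distrib_left using a upper(1)
    by (intro sum_mono) (simp add: divide_right_mono)
  moreover have "(\<Sum>i<k. a ^ Suc i * d i k) / a ^ k \<le> M * S"
  proof -
    have "(\<Sum>i<k. a ^ Suc i * d i k) \<le> a ^ k * S * M"
      unfolding T[symmetric] sum_distrib_right using a upper(2)
      by (intro sum_mono mult_left_mono) auto
    then show ?thesis
      using a by (simp add: field_simps)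
  qed
  ultimately have "a ^ k * m * S \<le> M * S"
    using bal by (simp add: algebra_simps)
  then show ?thesis
    using S_pos by simp
qed

section \<open>Competing walks and graded digraphs\<close>

lemma (in wf_digraph) stretch_preserving_two_paths:
  assumes pres: "stretch_preserving wG wH \<alpha>H \<alpha>G" and \<alpha>H: "\<alpha>H \<ge> 1" and \<alpha>G: "\<alpha>G \<ge> 0"
    and q: "apath s q t" and p: "awalk s p t"
    and only: "\<And>x. awalk s x t \<Longrightarrow> x = p \<or> x = q"
    and heavy: "awalk_cost wG q > \<alpha>G * awalk_cost wG p"
  shows "awalk_cost wH q > \<alpha>H * awalk_cost wH p"
proof (rule ccontr)
  \<comment> \<open>If \<open>q\<close> were this light, it would be an
    \<open>\<alpha>H\<close>-approximate shortest path for \<open>wH\<close>, its only rival being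
    \<open>p\<close>. Preservation would then carry it over to \<open>wG\<close>, where
    \<open>heavy\<close> excludes it.\<close>
  assume light: "\<not> ?thesis"
  have "set q \<subseteq> arcs G"
    using q by (auto simp: apath_def)
  then have "awalk_cost wH q \<ge> 0"
    using pres unfolding stretch_preserving_def positive_weights_def awalk_cost_def
    by (intro sum_list_nonneg) (auto intro: less_imp_le)
  \<comment> \<open>This covers the comparison of \<open>q\<close> with itself. The distance
    \<open>\<mu>\<close> is an infimum over all walks, which is why \<open>only\<close> speaks of
    walks and not just of paths.\<close>
  then have "awalk_cost wH q \<le> \<alpha>H * awalk_cost wH q"
    using mult_right_mono[OF \<alpha>H] by simp
  with light have le: "awalk_cost wH q / \<alpha>H \<le> awalk_cost wH x" if "awalk s x t" for x
    using only[OF that] \<alpha>H by (auto simp: field_simps)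
  have "ereal (awalk_cost wH q / \<alpha>H) \<le> \<mu> wH s t"
    unfolding \<mu>_def by (rule INF_greatest) (use le in auto)
  then have "ereal \<alpha>H * ereal (awalk_cost wH q / \<alpha>H) \<le> ereal \<alpha>H * \<mu> wH s t"
    using \<alpha>H by (intro ereal_mult_left_mono) auto
  then have "approx_shortest_path wH \<alpha>H s q t"
    using q \<alpha>H by (simp add: approx_shortest_path_def)
  then have "ereal (awalk_cost wG q) \<le> ereal \<alpha>G * \<mu> wG s t"
    using pres by (auto simp: stretch_preserving_def approx_shortest_path_def)
  also have "\<dots> \<le> ereal \<alpha>G * ereal (awalk_cost wG p)"
    using min_cost_le_walk_cost[OF p] \<alpha>G by (intro ereal_mult_left_mono) auto
  finally show False
    using heavy by simp
qed

text \<open>Every arc raises the rank by exactly one. For the grid this both excludes cycles and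
  fixes the length of a walk across a square.\<close>

lemma (in wf_digraph) awalk_graded_length:
  assumes grade: "\<And>e. e \<in> arcs G \<Longrightarrow> \<rho> (head G e) = Suc (\<rho> (tail G e))"
    and "awalk u p v"
  shows "\<rho> v = \<rho> u + length p"
  using assms(2)
proof (induction p arbitrary: u)
  case (Cons e p)
  then show ?case
    using grade[of e] by (auto simp: awalk_Cons_iff)
qed (simp add: awalk_Nil_iff)

section \<open>The weighted grid\<close>

definition right_arc :: "nat \<Rightarrow> nat \<Rightarrow> nat \<times> nat" where
  "right_arc i j = (prod_encode (i, j), prod_encode (i, Suc j))"

definition down_arc :: "nat \<Rightarrow> nat \<Rightarrow> nat \<times> nat" where
  "down_arc i j = (prod_encode (i, j), prod_encode (Suc i, j))"

text \<open>Vertices are codes of pairs (row, column), and an arc is the pair of its ends, so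
  parallel arcs cannot occur. Leaving \<open>V\<close> open makes room for the padding.\<close>

definition grid :: "nat \<Rightarrow> nat set \<Rightarrow> (nat, nat \<times> nat) pre_digraph" where
  "grid k V = \<lparr>verts = V,
     arcs = (\<lambda>(i, j). right_arc i j) ` ({..k} \<times> {..<k}) \<union> (\<lambda>(i, j). down_arc i j) ` ({..<k} \<times> {..k}),
     tail = fst, head = snd\<rparr>"

text \<open>Right arcs are recognised by staying in their row. The exponent \<open>k - i\<close>
  makes the weights fall from row to row without negative powers.\<close>

definition grid_weight :: "real \<Rightarrow> nat \<Rightarrow> nat \<times> nat \<Rightarrow> real" where
  "grid_weight b k e = (case map_prod prod_decode prod_decode e of ((i, j), (i', j')) \<Rightarrow>
     if i' = i then b ^ (k - i) else b ^ j)"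

lemma grid_weight_simps [simp]:
  "grid_weight b k (right_arc i j) = b ^ (k - i)"
  "grid_weight b k (down_arc i j) = b ^ j"
  by (simp_all add: grid_weight_def right_arc_def down_arc_def)

lemma grid_simps [simp]:
  "verts (grid k V) = V" "tail (grid k V) = fst" "head (grid k V) = snd"
  by (simp_all add: grid_def)

lemma arcs_grid:
  "e \<in> arcs (grid k V) \<longleftrightarrow>
     (\<exists>i j. i \<le> k \<and> j < k \<and> e = right_arc i j) \<or> (\<exists>i j. i < k \<and> j \<le> k \<and> e = down_arc i j)"
  by (auto simp: grid_def)

text \<open>The coordinate sum \<open>i + j\<close> is the rank function for
  \<open>awalk_graded_length\<close>.\<close>

lemma grid_arcs_graded:
  assumes "e \<in> arcs (grid k V)"
  shows "case_prod (+) (prod_decode (snd e)) = Suc (case_prod (+) (prod_decode (fst e)))"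
  using assms by (auto simp: arcs_grid right_arc_def down_arc_def)

context
  fixes k :: nat and V :: "nat set"
  assumes V: "finite V" "prod_encode ` ({..k} \<times> {..k}) \<subseteq> V"
begin

lemma grid_vertex: "i \<le> k \<Longrightarrow> j \<le> k \<Longrightarrow> prod_encode (i, j) \<in> V"
  using V by auto

lemma wf_digraph_grid: "wf_digraph (grid k V)"
  by unfold_locales (auto simp: arcs_grid right_arc_def down_arc_def grid_vertex)

lemma dag_grid: "dag (grid k V)"
proof -
  interpret wf_digraph "grid k V"
    by (rule wf_digraph_grid)
  show ?thesis
  proof unfold_locales
    show "finite (verts (grid k V))"
      using V by simp
    show "finite (arcs (grid k V))"
      by (simp add: grid_def)
    show "tail (grid k V) e \<noteq> head (grid k V) e" if "e \<in> arcs (grid k V)" for e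
      using grid_arcs_graded[OF that] by auto
    show "e1 = e2" if "arc_to_ends (grid k V) e1 = arc_to_ends (grid k V) e2" for e1 e2
      using that by (simp add: arc_to_ends_def prod_eq_iff)
    show "\<not> cycle p" for p
    proof
      assume "cycle p"
      then obtain u where "awalk u p u" "p \<noteq> []"
        by (auto simp: cycle_def)
      \<comment> \<open>The rank would have to grow by \<open>length p > 0\<close> along a walk that
        returns to \<open>u\<close>.\<close>
      then show False
        using awalk_graded_length[of "\<lambda>v. case_prod (+) (prod_decode v)" u p u] grid_arcs_graded
        by simp
    qed
  qed
qed

lemma positive_grid_weight: "b > 0 \<Longrightarrow> positive_weights (grid k V) (grid_weight b k)"
  by (auto simp: positive_weights_def arcs_grid)

text \<open>The rank rises by two between opposite corners, so a walk has exactly two arcs; one must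
  go right and the other down, in either order.\<close>

lemma grid_square_awalks:
  assumes ij: "i < k" "j < k"
  defines "p \<equiv> [down_arc i j, right_arc (Suc i) j]" and "q \<equiv> [right_arc i j, down_arc i (Suc j)]"
    and "s \<equiv> prod_encode (i, j)" and "t \<equiv> prod_encode (Suc i, Suc j)"
  shows "pre_digraph.awalk (grid k V) s x t \<longleftrightarrow> x = p \<or> x = q"
    and "pre_digraph.apath (grid k V) s q t"
proof -
  interpret wf_digraph "grid k V"
    by (rule wf_digraph_grid)
  have arcs: "right_arc i j \<in> arcs (grid k V)" "down_arc i (Suc j) \<in> arcs (grid k V)"
    "down_arc i j \<in> arcs (grid k V)" "right_arc (Suc i) j \<in> arcs (grid k V)"
    using ij unfolding arcs_grid by (metis Suc_leI less_imp_le)+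
  show "apath s q t"
    using arcs ij by (auto simp: q_def s_def t_def apath_simps right_arc_def down_arc_def grid_vertex)
  show "awalk s x t \<longleftrightarrow> x = p \<or> x = q"
  proof
    assume x: "awalk s x t"
    then have "length x = 2"
      using awalk_graded_length[of "\<lambda>v. case_prod (+) (prod_decode v)" s x t] grid_arcs_graded
      by (simp add: s_def t_def)
    then obtain e f where "x = [e, f]"
      by (auto simp: length_Suc_conv numeral_2_eq_2)
    with x show "x = p \<or> x = q"
      by (auto simp: awalk_simps arcs_grid p_def q_def s_def t_def right_arc_def down_arc_def)
  next
    assume "x = p \<or> x = q"
    then show "awalk s x t"
      using arcs ij
      by (auto simp: p_def q_def s_def t_def awalk_simps right_arc_def down_arc_def grid_vertex)
  qed
qed

lemma grid_stretch_preserving_aspect_ratio: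
  assumes k: "k > 0" and \<alpha>: "\<alpha>H > 1" "\<alpha>G > 1"
    and pres: "wf_digraph.stretch_preserving (grid k V) (grid_weight (2 * \<alpha>G) k) wH \<alpha>H \<alpha>G"
  shows "\<alpha>H ^ k \<le> aspect_ratio (grid k V) wH"
proof -
  interpret dag "grid k V"
    by (rule dag_grid)
  let ?A = "wH ` arcs (grid k V)"
  have right: "wH (right_arc i j) \<in> ?A" if "i \<le> k" "j < k" for i j
    using that by (intro imageI) (auto simp: arcs_grid)
  have down: "wH (down_arc i j) \<in> ?A" if "i < k" "j \<le> k" for i j
    using that by (intro imageI) (auto simp: arcs_grid)
  have fin: "finite ?A"
    by simp
  have "?A \<noteq> {}"
    using right[of 0 0] k by auto
  then have "Min ?A \<in> ?A"
    by (rule Min_in[OF fin])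
  then have Min_pos: "Min ?A > 0"
    using pres by (auto simp: stretch_preserving_def positive_weights_def)
  \<comment> \<open>With \<open>M\<close> and \<open>m\<close> the extreme weights, the boundary
    bounds are immediate and only the squares need an argument.\<close>
  have "\<alpha>H ^ k * Min ?A \<le> Max ?A"
  proof (rule grid_inequalities_imp_ratio)
    fix i j assume ij: "i < k" "j < k"
    let ?p = "[down_arc i j, right_arc (Suc i) j]" and ?q = "[right_arc i j, down_arc i (Suc j)]"
    let ?w = "grid_weight (2 * \<alpha>G) k"
    have pos: "awalk_cost ?w ?p > 0"
      using \<alpha> by (simp add: add_pos_pos)
    \<comment> \<open>Each arc of \<open>?q\<close> is \<open>2 * \<alpha>G\<close> times as heavy
      as the parallel arc of \<open>?p\<close>. The factor 2 makes the excess over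
      \<open>\<alpha>G\<close> strict.\<close>
    have "k - i = Suc (k - Suc i)"
      using ij by simp
    then have "awalk_cost ?w ?q = 2 * \<alpha>G * awalk_cost ?w ?p"
      by (simp add: algebra_simps)
    then have "awalk_cost ?w ?q > \<alpha>G * awalk_cost ?w ?p"
      using mult_pos_pos[OF _ pos, of \<alpha>G] \<alpha> by linarith
    then have "awalk_cost wH ?q > \<alpha>H * awalk_cost wH ?p"
      using \<alpha> grid_square_awalks[OF ij] by (intro stretch_preserving_two_paths[OF pres]) auto
    then show "\<alpha>H * (wH (down_arc i j) + wH (right_arc (Suc i) j)) \<le>
        wH (right_arc i j) + wH (down_arc i (Suc j))"
      by simp
  qed (use \<alpha> k right down in \<open>auto intro!: Max_ge Min_le fin\<close>)
  then show ?thesis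
    using Min_pos by (simp add: aspect_ratio_def field_simps)
qed

end

section \<open>Choosing the grid size and padding to \<open>n\<close> vertices\<close>

theorem theorem1p10:
  shows "\<exists>c::real. c > 0 \<and> (\<exists>n\<^sub>0::nat. \<forall>(\<alpha>\<^sub>H::real) (\<alpha>\<^sub>G::real) (n::nat).
    \<alpha>\<^sub>H > 1 \<longrightarrow> \<alpha>\<^sub>G > 1 \<longrightarrow> n \<ge> n\<^sub>0 \<longrightarrow>
    (\<exists>(G :: (nat, nat \<times> nat) pre_digraph) w\<^sub>G.
       dag G \<and> card (verts G) = n \<and> arcs G \<noteq> {} \<and> positive_weights G w\<^sub>G \<and>
       (\<forall>w\<^sub>H. wf_digraph.stretch_preserving G w\<^sub>G w\<^sub>H \<alpha>\<^sub>H \<alpha>\<^sub>G \<longrightarrow>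
          aspect_ratio G w\<^sub>H \<ge> \<alpha>\<^sub>H powr (c * sqrt (real n)))))"
proof (intro exI[of _ "1 / 3"] conjI exI[of _ 4] allI impI)
  fix \<alpha>H \<alpha>G :: real and n :: nat
  assume \<alpha>: "\<alpha>H > 1" "\<alpha>G > 1" and n: "4 \<le> n"
  \<comment> \<open>A grid of side \<open>k + 1\<close> is the largest square grid with at most
    \<open>n\<close> vertices.\<close>
  define k where "k = nat \<lfloor>sqrt n\<rfloor> - 1"
  have "2 \<le> sqrt n"
    using n by (intro real_le_rsqrt) simp
  then have "real k + 1 \<le> sqrt n" "sqrt n < real k + 2" and k: "k > 0"
    unfolding k_def by linarith+
  \<comment> \<open>Since \<open>n \<ge> 4\<close> gives \<open>k \<ge> 1\<close>, we have
    \<open>k + 2 \<le> 3 * k\<close>; hence the constant 1/3.\<close>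
  then have exponent: "1 / 3 * sqrt n \<le> real k"
    by linarith
  have "(real k + 1)\<^sup>2 \<le> n"
    using \<open>real k + 1 \<le> sqrt n\<close> power_mono[of "real k + 1" "sqrt n" 2] by simp
  then have "real (Suc k * Suc k) \<le> real n"
    by (simp add: power2_eq_square algebra_simps)
  then have "Suc k * Suc k \<le> n"
    by (simp only: of_nat_le_iff)
  then have "card (prod_encode ` ({..k} \<times> {..k})) \<le> n"
    by (simp add: card_image inj_prod_encode)
  \<comment> \<open>Infinitely many naturals are not codes of grid points; the isolated vertices
    \<open>B\<close> are taken from these.\<close>
  moreover have "infinite (UNIV - prod_encode ` ({..k} \<times> {..k}))"
    by (intro Diff_infinite_finite) auto
  then obtain B where B: "finite B" "card B = n - card (prod_encode ` ({..k} \<times> {..k}))"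
      "B \<subseteq> UNIV - prod_encode ` ({..k} \<times> {..k})"
    by (meson infinite_arbitrarily_large)
  define V where "V = prod_encode ` ({..k} \<times> {..k}) \<union> B"
  ultimately have V: "prod_encode ` ({..k} \<times> {..k}) \<subseteq> V" "finite V" "card V = n"
    using B by (auto simp: V_def card_Un_disjoint Diff_eq disjoint_eq_subset_Compl Int_commute)
  have "right_arc 0 0 \<in> arcs (grid k V)"
    using k by (auto simp: arcs_grid)
  moreover have "\<alpha>H powr (1 / 3 * sqrt n) \<le> aspect_ratio (grid k V) w"
    if "wf_digraph.stretch_preserving (grid k V) (grid_weight (2 * \<alpha>G) k) w \<alpha>H \<alpha>G" for w
  proof -
    have "\<alpha>H powr (1 / 3 * sqrt n) \<le> \<alpha>H powr real k"
      using exponent \<alpha> by (intro powr_mono) auto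
    also have "\<dots> = \<alpha>H ^ k"
      using \<alpha> by (simp add: powr_realpow)
    also have "\<dots> \<le> aspect_ratio (grid k V) w"
      by (rule grid_stretch_preserving_aspect_ratio[OF V(2,1) k \<alpha> that])
    finally show ?thesis .
  qed
  ultimately show "\<exists>(G :: (nat, nat \<times> nat) pre_digraph) w\<^sub>G.
       dag G \<and> card (verts G) = n \<and> arcs G \<noteq> {} \<and> positive_weights G w\<^sub>G \<and>
       (\<forall>w\<^sub>H. wf_digraph.stretch_preserving G w\<^sub>G w\<^sub>H \<alpha>H \<alpha>G \<longrightarrow>
          aspect_ratio G w\<^sub>H \<ge> \<alpha>H powr (1 / 3 * sqrt n))"
    using dag_grid[OF V(2,1)] positive_grid_weight[OF V(2,1)] V(3) \<alpha>
    by (intro exI[of _ "grid k V"] exI[of _ "grid_weight (2 * \<alpha>G) k"]) auto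
qed simp

end
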